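(* For any $n\in\mathbb{N}$, $\boldsymbol{\mathcal{V}}(\mathsf{rPS}_n)$ does not contain $\mathsf{styl}_{n+2}$.
   Context: $\mathbb{N}=\{1,2,3,\dots\}$, and for $n\in\mathbb{N}$ let $\mathcal{A}_n=\{1<2<\cdots<n\}$. The stylic monoid of rank $n$, $\mathsf{styl}_n$, is the monoid presented by generators $\mathcal{A}_n$ and relations $acb=cab$ (for $a\le b<c$), $bac=bca$ (for $a<b\le c$), and $a^2=a$ (for $a\in\mathcal{A}_n$). The right patience-sorting monoid of rank $n$, $\mathsf{rPS}_n$, is the quotient of the free monoid $\mathcal{A}_n^*$ by the congruence identifying two words when they produce the same right patience-sorting tableau. The tableau of a word is a finite left-to-right sequence of bottom-aligned columns of letters, obtained by starting from the empty tableau and inserting the letters of the word one by one from left to right as follows: to insert a letter $a$, if $a$ is strictly greater than every bottom entry of the columns, add a new column consisting of $a$ at the right; otherwise, let $C$ be the leftmost column whose bottom entry is $\ge a$, and place $a$ at the bottom of $C$, below all its previous entries (so columns weakly decrease from top to bottom and the bottom row is strictly increasing from left to right). A variety is a class of monoids closed under homomorphic images, submonoids and direct products; $\boldsymbol{\mathcal{V}}(M)$ is the variety generated by the monoid $M$. *)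

theory Defs
  imports "HOL-Algebra.Product_Groups"
begin

section \<open>Quotients of free monoids\<close>

text \<open>The quotient of the free monoid over \<open>A\<close> by a congruence \<open>r\<close> on \<open>lists A\<close>.  As usual for
  equivalence classes, the product of two classes is written as the union of the classes
  of all products of representatives.\<close>

definition word_quotient :: "'a set \<Rightarrow> ('a list \<times> 'a list) set \<Rightarrow> 'a list set monoid" where
  "word_quotient A r =
     \<lparr>carrier = lists A // r,
      monoid.mult = (\<lambda>X Y. \<Union>x\<in>X. \<Union>y\<in>Y. r `` {x @ y}),
      one = r `` {[]}\<rparr>"

inductive_set generated_congruence ::
    "'a set \<Rightarrow> ('a list \<times> 'a list) set \<Rightarrow> ('a list \<times> 'a list) set"
  for A :: "'a set" and R :: "('a list \<times> 'a list) set" where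
  base: "(u, v) \<in> R \<Longrightarrow> u \<in> lists A \<Longrightarrow> v \<in> lists A \<Longrightarrow> (u, v) \<in> generated_congruence A R"
| refl: "w \<in> lists A \<Longrightarrow> (w, w) \<in> generated_congruence A R"
| sym: "(u, v) \<in> generated_congruence A R \<Longrightarrow> (v, u) \<in> generated_congruence A R"
| trans: "(u, v) \<in> generated_congruence A R \<Longrightarrow> (v, w) \<in> generated_congruence A R \<Longrightarrow>
    (u, w) \<in> generated_congruence A R"
| append: "(u, v) \<in> generated_congruence A R \<Longrightarrow> (u', v') \<in> generated_congruence A R \<Longrightarrow>
    (u @ u', v @ v') \<in> generated_congruence A R"

definition presented_monoid :: "'a set \<Rightarrow> ('a list \<times> 'a list) set \<Rightarrow> 'a list set monoid" where
  "presented_monoid A R = word_quotient A (generated_congruence A R)"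


section \<open>The stylic monoid\<close>

definition stylic_relations :: "nat \<Rightarrow> (nat list \<times> nat list) set" where
  "stylic_relations n =
     {([a, c, b], [c, a, b]) | a b c. {a, b, c} \<subseteq> {1..n} \<and> a \<le> b \<and> b < c} \<union>
     {([b, a, c], [b, c, a]) | a b c. {a, b, c} \<subseteq> {1..n} \<and> a < b \<and> b \<le> c} \<union>
     {([a, a], [a]) | a. a \<in> {1..n}}"

definition styl :: "nat \<Rightarrow> nat list set monoid" where
  "styl n = presented_monoid {1..n} (stylic_relations n)"


section \<open>The right patience-sorting monoid\<close>

text \<open>A tableau is the list of its columns from left to right, each column being the nonempty
  list of its entries from top to bottom; so \<open>last C\<close> is the bottom entry of the column \<open>C\<close>.\<close>

fun rps_insert :: "nat \<Rightarrow> nat list list \<Rightarrow> nat list list" where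
  "rps_insert a [] = [[a]]"
| "rps_insert a (C # T) = (if a \<le> last C then (C @ [a]) # T else C # rps_insert a T)"

definition rps_tableau :: "nat list \<Rightarrow> nat list list" where
  "rps_tableau w = fold rps_insert w []"

definition rps_congruence :: "nat \<Rightarrow> (nat list \<times> nat list) set" where
  "rps_congruence n =
     {(u, v). u \<in> lists {1..n} \<and> v \<in> lists {1..n} \<and> rps_tableau u = rps_tableau v}"

definition rPS :: "nat \<Rightarrow> nat list set monoid" where
  "rPS n = word_quotient {1..n} (rps_congruence n)"


section \<open>Varieties of monoids\<close>

text \<open>A class of monoids is represented by the set of those of its members whose elements are
  taken from a type \<open>'u\<close>, which plays the role of a universe; statements about varieties are meant
  to be polymorphic in \<open>'u\<close>.

  Homomorphic images are given by \<^const>\<open>epi\<close>: a surjective multiplicative map between monoids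
  preserves the identity.  Taking \<open>H\<close> isomorphic to \<open>G\<close> shows that varieties are closed under
  isomorphism.  The carrier of a direct product is a set of functions, hence closure under
  products is stated for the isomorphic copies in \<open>'u\<close> of such products.  It is enough to consider
  index sets contained in \<open>'u\<close>: trivial factors do not matter, and the product of a family
  of nontrivial monoids has more elements than the family has members.\<close>

definition monoid_variety :: "'u monoid set \<Rightarrow> bool" where
  "monoid_variety K \<longleftrightarrow>
     (\<forall>G\<in>K. monoid G) \<and>
     (\<forall>G\<in>K. \<forall>H. monoid H \<and> epi G H \<noteq> {} \<longrightarrow> H \<in> K) \<and>
     (\<forall>G\<in>K. \<forall>S. submonoid S G \<longrightarrow> G\<lparr>carrier := S\<rparr> \<in> K) \<and>
     (\<forall>(I :: 'u set) F P. (\<forall>i\<in>I. F i \<in> K) \<and> monoid P \<and> P \<cong> product_group I F \<longrightarrow> P \<in> K)"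

text \<open>The monoid \<open>M\<close> itself need not have its elements in \<open>'u\<close>, so it enters through its
  isomorphic copies.\<close>

definition variety_generated_by :: "('m, 'b) monoid_scheme \<Rightarrow> 'u monoid set" where
  "variety_generated_by M = \<Inter>{K. monoid_variety K \<and> {G. monoid G \<and> G \<cong> M} \<subseteq> K}"


section \<open>Well-definedness\<close>

lemma mult_word_quotient:
  assumes eq: "equiv (lists A) r"
    and app: "\<And>u v u' v'. (u, v) \<in> r \<Longrightarrow> (u', v') \<in> r \<Longrightarrow> (u @ u', v @ v') \<in> r"
    and uv: "u \<in> lists A" "v \<in> lists A"
  shows "r `` {u} \<otimes>\<^bsub>word_quotient A r\<^esub> r `` {v} = r `` {u @ v}"
proof -
  have rf: "(u, u) \<in> r" "(v, v) \<in> r"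
    using eq uv by (auto simp: equiv_def refl_on_def)
  have "r `` {x @ y} = r `` {u @ v}" if "(u, x) \<in> r" "(v, y) \<in> r" for x y
    using equiv_class_eq[OF eq app[OF that]] by simp
  then have "(\<Union>x\<in>r `` {u}. \<Union>y\<in>r `` {v}. r `` {x @ y}) = r `` {u @ v}"
    using rf by blast
  then show ?thesis by (simp add: word_quotient_def)
qed

lemma monoid_word_quotient:
  assumes eq: "equiv (lists A) r"
    and app: "\<And>u v u' v'. (u, v) \<in> r \<Longrightarrow> (u', v') \<in> r \<Longrightarrow> (u @ u', v @ v') \<in> r"
  shows "monoid (word_quotient A r)"
proof -
  let ?Q = "word_quotient A r"
  have car: "X \<in> carrier ?Q \<longleftrightarrow> (\<exists>u\<in>lists A. X = r `` {u})" for X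
    by (auto simp: word_quotient_def quotient_def)
  have one: "\<one>\<^bsub>?Q\<^esub> = r `` {[]}" by (simp add: word_quotient_def)
  have mult: "r `` {u} \<otimes>\<^bsub>?Q\<^esub> r `` {v} = r `` {u @ v}"
    if "u \<in> lists A" "v \<in> lists A" for u v
    using mult_word_quotient[OF eq _ that] app by blast
  show ?thesis
  proof (rule monoidI)
    fix X Y assume "X \<in> carrier ?Q" "Y \<in> carrier ?Q"
    then obtain u v where "u \<in> lists A" "v \<in> lists A" "X = r `` {u}" "Y = r `` {v}"
      unfolding car by blast
    then show "X \<otimes>\<^bsub>?Q\<^esub> Y \<in> carrier ?Q" by (auto simp: mult car intro!: bexI[of _ "u @ v"])
  next
    show "\<one>\<^bsub>?Q\<^esub> \<in> carrier ?Q" unfolding car one by (intro bexI[of _ "[]"]) auto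
  next
    fix X Y Z assume "X \<in> carrier ?Q" "Y \<in> carrier ?Q" "Z \<in> carrier ?Q"
    then obtain u v w where "u \<in> lists A" "v \<in> lists A" "w \<in> lists A"
      "X = r `` {u}" "Y = r `` {v}" "Z = r `` {w}"
      unfolding car by blast
    then show "X \<otimes>\<^bsub>?Q\<^esub> Y \<otimes>\<^bsub>?Q\<^esub> Z = X \<otimes>\<^bsub>?Q\<^esub> (Y \<otimes>\<^bsub>?Q\<^esub> Z)"
      using mult[of u v] mult[of v w] mult[of "u @ v" w] mult[of u "v @ w"] by simp
  next
    fix X assume "X \<in> carrier ?Q"
    then obtain u where "u \<in> lists A" "X = r `` {u}" unfolding car by blast
    then show "\<one>\<^bsub>?Q\<^esub> \<otimes>\<^bsub>?Q\<^esub> X = X" "X \<otimes>\<^bsub>?Q\<^esub> \<one>\<^bsub>?Q\<^esub> = X"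
      using mult[of "[]" u] mult[of u "[]"] by (simp_all add: one)
  qed
qed

lemma generated_congruence_lists:
  "(u, v) \<in> generated_congruence A R \<Longrightarrow> u \<in> lists A \<and> v \<in> lists A"
  by (induction rule: generated_congruence.induct) auto

lemma equiv_generated_congruence: "equiv (lists A) (generated_congruence A R)"
  by (rule equivI)
    (auto simp: refl_on_def sym_def trans_def dest: generated_congruence_lists
      intro: generated_congruence.intros)

lemma monoid_presented_monoid: "monoid (presented_monoid A R)"
  unfolding presented_monoid_def
  by (rule monoid_word_quotient[OF equiv_generated_congruence generated_congruence.append])

lemma monoid_styl: "monoid (styl n)"
  unfolding styl_def by (rule monoid_presented_monoid)

text \<open>Equality of tableaux is a left congruence: prepending a letter \<open>a\<close> to a word changes its
  tableau \<open>T\<close> into \<open>rps_prepend [a] T\<close>, where entries displaced from a column are put on top of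
  the next one.\<close>

fun rps_prepend :: "nat list \<Rightarrow> nat list list \<Rightarrow> nat list list" where
  "rps_prepend D [] = [D]"
| "rps_prepend D (C # T) = (D @ filter (\<lambda>x. x \<le> last D) C) #
     (if filter (\<lambda>x. x > last D) C = [] then T
      else rps_prepend (filter (\<lambda>x. x > last D) C) T)"

fun rps_ok :: "nat list list \<Rightarrow> bool" where
  "rps_ok [] \<longleftrightarrow> True"
| "rps_ok (C # T) \<longleftrightarrow> C \<noteq> [] \<and> (\<forall>x\<in>set C. last C \<le> x) \<and>
     (T = [] \<or> last C < last (hd T)) \<and> rps_ok T"

lemma rps_ok_insert: "rps_ok T \<Longrightarrow> rps_ok (rps_insert a T)"
proof (induction T)
  case (Cons C T)
  have C: "C \<noteq> []" "\<forall>x\<in>set C. last C \<le> x" "rps_ok T"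
    and T: "T = [] \<or> last C < last (hd T)"
    using Cons.prems unfolding rps_ok.simps by blast+
  show ?case
  proof (cases "a \<le> last C")
    case True
    then have eq: "rps_insert a (C # T) = (C @ [a]) # T" by simp
    have "a \<le> x" if "x \<in> set (C @ [a])" for x
      using that order.trans[OF True bspec[OF C(2)], of x] by auto
    moreover have "T = [] \<or> a < last (hd T)"
      using T True by linarith
    ultimately show ?thesis using C(3) unfolding eq rps_ok.simps last_snoc by blast
  next
    case False
    then have eq: "rps_insert a (C # T) = C # rps_insert a T" by simp
    have "last C < last (hd (rps_insert a T))"
      using T False by (cases T) simp_all
    then show ?thesis using C Cons.IH[OF C(3)] unfolding eq rps_ok.simps by blast
  qed
qed simp

lemma rps_ok_fold: "rps_ok T \<Longrightarrow> rps_ok (fold rps_insert w T)"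
  by (induction w arbitrary: T) (auto simp: rps_ok_insert)

lemma rps_prepend_snoc:
  assumes "rps_ok (C # T)" "b \<le> last C"
  shows "rps_prepend (C @ [b]) T = rps_insert b (rps_prepend C T)"
proof (cases T)
  case Nil
  then show ?thesis using assms(2) by simp
next
  case (Cons C2 T2)
  have gt: "last C < x" if "x \<in> set C2" for x
  proof -
    have "last C < last C2" "last C2 \<le> x"
      using assms(1) that unfolding Cons rps_ok.simps list.sel by blast+
    then show ?thesis by (rule less_le_trans)
  qed
  have flt: "filter (\<lambda>x. x \<le> d) C2 = []" "filter (\<lambda>x. x > d) C2 = C2"
    if "d \<le> last C" for d
    unfolding filter_empty_conv filter_id_conv
    using gt le_less_trans[OF that] leD by blast+
  note f = flt[OF order.refl] flt[OF assms(2)]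
  show ?thesis using assms(2) by (simp add: Cons f)
qed

lemma last_append_filter_le:
  assumes "\<forall>x\<in>set C. last C \<le> (x :: nat)" "C \<noteq> []"
  shows "last (D @ filter (\<lambda>x. x \<le> d) C) = (if last C \<le> d then last C else last D)"
proof -
  obtain B c where C: "C = B @ [c]" using assms(2) by (cases C rule: rev_cases) auto
  have "filter (\<lambda>x. x \<le> d) C = []" if "\<not> c \<le> d"
    unfolding filter_empty_conv using assms(1) that order.trans by (simp add: C) blast
  then show ?thesis by (cases "c \<le> d") (simp_all add: C)
qed

lemma rps_prepend_insert:
  "rps_ok T \<Longrightarrow> D \<noteq> [] \<Longrightarrow>
     rps_prepend D (rps_insert b T) = rps_insert b (rps_prepend D T)"
proof (induction T arbitrary: D)
  case Nil
  then show ?case by auto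
next
  case (Cons C T)
  have C: "C \<noteq> []" "\<forall>x\<in>set C. last C \<le> x" "rps_ok T"
    using Cons.prems(1) unfolding rps_ok.simps by blast+
  note l = last_append_filter_le[OF C(2,1), of D "last D"]
  show ?case
  proof (cases "b \<le> last C")
    case bC: True
    show ?thesis
    proof (cases "b \<le> last D")
      case True
      then show ?thesis using bC l by auto
    next
      case False
      have "filter (\<lambda>x. x \<le> last D) C = []" "filter (\<lambda>x. x > last D) C = C"
        unfolding filter_empty_conv filter_id_conv using False bC C(2) by force+
      then show ?thesis using bC False C Cons.prems by (simp add: rps_prepend_snoc)
    qed
  next
    case bC: False
    show ?thesis
    proof (cases "last C \<le> last D")
      case True
      then show ?thesis using bC l Cons.IH[OF C(3)] by auto
    next
      case False
      then have "last C \<in> set (filter (\<lambda>x. x > last D) C)" using C(1) by simp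
      then have "filter (\<lambda>x. x > last D) C \<noteq> []" by force
      then show ?thesis using False bC l Cons.IH[OF C(3)] by auto
    qed
  qed
qed

lemma rps_prepend_fold:
  "rps_ok T \<Longrightarrow> D \<noteq> [] \<Longrightarrow>
     fold rps_insert w (rps_prepend D T) = rps_prepend D (fold rps_insert w T)"
  by (induction w arbitrary: T) (auto simp: rps_ok_insert simp flip: rps_prepend_insert)

lemma rps_tableau_Cons: "rps_tableau (a # w) = rps_prepend [a] (rps_tableau w)"
  using rps_prepend_fold[of "[]" "[a]" w] by (simp add: rps_tableau_def)

lemma rps_tableau_append_cong:
  assumes "rps_tableau u = rps_tableau v" "rps_tableau u' = rps_tableau v'"
  shows "rps_tableau (u @ u') = rps_tableau (v @ v')"
proof -
  have "rps_tableau (u @ u') = rps_tableau (u @ v')"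
    by (induction u) (simp_all add: assms(2) rps_tableau_Cons)
  also have "\<dots> = rps_tableau (v @ v')"
    using assms(1) by (simp add: rps_tableau_def)
  finally show ?thesis .
qed

lemma monoid_rPS: "monoid (rPS n)"
  unfolding rPS_def
proof (rule monoid_word_quotient)
  show "equiv (lists {1..n}) (rps_congruence n)"
    by (rule equivI) (auto simp: rps_congruence_def refl_on_def sym_def trans_def)
qed (auto simp: rps_congruence_def intro: rps_tableau_append_cong)

end

theory Submission
  imports Defs "HOL-Library.Sublist"
begin

text \<open>
  The two monoids are separated by the identity \<open>(x y)\<^sup>n x y = (x y)\<^sup>n y x\<close>.

  It holds in \<^term>\<open>rPS n\<close>: each further copy of a word \<open>z\<close> makes at least the next smallest
  letter of \<open>z\<close> a permanent bottom entry, so after \<open>n\<close> copies every letter of \<open>z\<close> is the bottom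
  of a column.  From then on a letter of \<open>z\<close> is just appended to its own column, and the order
  in which the letters arrive is irrelevant.

  It fails in \<^term>\<open>styl (n + 2)\<close>: the stylic relations preserve the maximal length of a strictly
  decreasing subword.  For \<open>x = 2 3 \<dots> (n + 2)\<close> and \<open>y = 1\<close> the left-hand side contains
  \<open>(n + 2) \<dots> 2 1\<close>, whereas on the right-hand side each copy of \<open>x\<close> contributes at most one letter,
  and the last copy comes after the last \<open>y\<close>.
\<close>

section \<open>The separating identity\<close>

definition swap_law :: "nat \<Rightarrow> ('a, 'b) monoid_scheme \<Rightarrow> bool" where
  "swap_law n G \<longleftrightarrow> (\<forall>x\<in>carrier G. \<forall>y\<in>carrier G.
     (x \<otimes>\<^bsub>G\<^esub> y) [^]\<^bsub>G\<^esub> n \<otimes>\<^bsub>G\<^esub> (x \<otimes>\<^bsub>G\<^esub> y) = (x \<otimes>\<^bsub>G\<^esub> y) [^]\<^bsub>G\<^esub> n \<otimes>\<^bsub>G\<^esub> (y \<otimes>\<^bsub>G\<^esub> x))"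

text \<open>The additional factor \<open>y\<close> makes it unnecessary that \<open>h\<close> preserves the identity element.\<close>

lemma hom_nat_pow_mult:
  assumes "monoid G" "monoid H" and h: "h \<in> hom G H" and x: "x \<in> carrier G"
  shows "y \<in> carrier G \<Longrightarrow> h (x [^]\<^bsub>G\<^esub> (n::nat) \<otimes>\<^bsub>G\<^esub> y) = h x [^]\<^bsub>H\<^esub> n \<otimes>\<^bsub>H\<^esub> h y"
proof (induction n arbitrary: y)
  case 0
  interpret G: monoid G by fact
  interpret H: monoid H by fact
  show ?case using 0 hom_in_carrier[OF h] by simp
next
  case (Suc n)
  interpret G: monoid G by fact
  interpret H: monoid H by fact
  show ?case
    using Suc.IH[of "x \<otimes>\<^bsub>G\<^esub> y"] Suc.prems x hom_in_carrier[OF h] hom_mult[OF h x, of y]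
    by (simp add: G.m_assoc H.m_assoc)
qed

section \<open>Stability of the identity under the variety operations\<close>

lemma swap_law_epi:
  assumes "monoid G" "monoid H" "h \<in> epi G H" "swap_law n G"
  shows "swap_law n H"
  unfolding swap_law_def
proof (intro ballI)
  fix a b assume "a \<in> carrier H" "b \<in> carrier H"
  moreover have h: "h \<in> hom G H" and im: "h ` carrier G = carrier H"
    using assms(3) by (auto simp: epi_def)
  ultimately obtain x y where xy: "x \<in> carrier G" "y \<in> carrier G" "a = h x" "b = h y"
    by blast
  have mem: "x \<otimes>\<^bsub>G\<^esub> y \<in> carrier G" "y \<otimes>\<^bsub>G\<^esub> x \<in> carrier G"
    using xy \<open>monoid G\<close> by (auto intro: monoid.m_closed)
  have "h ((x \<otimes>\<^bsub>G\<^esub> y) [^]\<^bsub>G\<^esub> n \<otimes>\<^bsub>G\<^esub> (x \<otimes>\<^bsub>G\<^esub> y)) = h ((x \<otimes>\<^bsub>G\<^esub> y) [^]\<^bsub>G\<^esub> n \<otimes>\<^bsub>G\<^esub> (y \<otimes>\<^bsub>G\<^esub> x))"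
    using bspec[OF bspec[OF assms(4)[unfolded swap_law_def] xy(1)] xy(2)] by simp
  then show "(a \<otimes>\<^bsub>H\<^esub> b) [^]\<^bsub>H\<^esub> n \<otimes>\<^bsub>H\<^esub> (a \<otimes>\<^bsub>H\<^esub> b) = (a \<otimes>\<^bsub>H\<^esub> b) [^]\<^bsub>H\<^esub> n \<otimes>\<^bsub>H\<^esub> (b \<otimes>\<^bsub>H\<^esub> a)"
    using mem by (simp add: xy(3,4) hom_nat_pow_mult[OF assms(1,2) h]
        hom_mult[OF h xy(1,2)] hom_mult[OF h xy(2,1)])
qed

text \<open>The identity can be tested after applying homomorphisms that jointly separate points.
  Submonoids, products and isomorphic copies are all instances of this one argument.\<close>

lemma swap_law_separated:
  assumes P: "monoid P"
    and sep: "\<And>p q. p \<in> carrier P \<Longrightarrow> q \<in> carrier P \<Longrightarrow>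
      (\<And>G h. monoid (G :: 'u monoid) \<Longrightarrow> swap_law n G \<Longrightarrow> h \<in> hom P G \<Longrightarrow> h p = h q) \<Longrightarrow> p = q"
  shows "swap_law n P"
  unfolding swap_law_def
proof (intro ballI)
  interpret P: monoid P by fact
  fix x y assume xy: "x \<in> carrier P" "y \<in> carrier P"
  show "(x \<otimes>\<^bsub>P\<^esub> y) [^]\<^bsub>P\<^esub> n \<otimes>\<^bsub>P\<^esub> (x \<otimes>\<^bsub>P\<^esub> y) = (x \<otimes>\<^bsub>P\<^esub> y) [^]\<^bsub>P\<^esub> n \<otimes>\<^bsub>P\<^esub> (y \<otimes>\<^bsub>P\<^esub> x)"
  proof (rule sep)
    fix G h assume G: "monoid (G :: 'u monoid)" "swap_law n G" and h: "h \<in> hom P G"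
    show "h ((x \<otimes>\<^bsub>P\<^esub> y) [^]\<^bsub>P\<^esub> n \<otimes>\<^bsub>P\<^esub> (x \<otimes>\<^bsub>P\<^esub> y)) = h ((x \<otimes>\<^bsub>P\<^esub> y) [^]\<^bsub>P\<^esub> n \<otimes>\<^bsub>P\<^esub> (y \<otimes>\<^bsub>P\<^esub> x))"
      using bspec[OF bspec[OF G(2)[unfolded swap_law_def]], of "h x" "h y"]
        hom_in_carrier[OF h] xy
      by (simp add: hom_nat_pow_mult[OF P G(1) h] hom_mult[OF h xy] hom_mult[OF h xy(2,1)])
  qed (use xy in auto)
qed

lemma monoid_variety_swap_law: "monoid_variety {G :: 'u monoid. monoid G \<and> swap_law n G}"
  unfolding monoid_variety_def
proof (intro conjI ballI allI impI)
  fix G H :: "'u monoid"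
  assume "G \<in> {G. monoid G \<and> swap_law n G}" "monoid H \<and> epi G H \<noteq> {}"
  then show "H \<in> {G. monoid G \<and> swap_law n G}"
    using swap_law_epi by blast
next
  fix G :: "'u monoid" and S
  assume G: "G \<in> {G. monoid G \<and> swap_law n G}" and S: "submonoid S G"
  have M: "monoid (G\<lparr>carrier := S\<rparr>)"
    using G S by (auto intro: submonoid.submonoid_is_monoid)
  have "swap_law n (G\<lparr>carrier := S\<rparr>)"
  proof (rule swap_law_separated[OF M])
    fix p q
    assume *: "\<And>(K :: 'u monoid) h. monoid K \<Longrightarrow> swap_law n K \<Longrightarrow>
      h \<in> hom (G\<lparr>carrier := S\<rparr>) K \<Longrightarrow> h p = h q"
    \<comment> \<open>The inclusion alone separates the points of a submonoid.\<close>
    have "(\<lambda>x. x) \<in> hom (G\<lparr>carrier := S\<rparr>) G"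
      using submonoid.subset[OF S] by (auto simp: hom_def)
    from *[OF _ _ this] show "p = q" using G by auto
  qed
  with M show "G\<lparr>carrier := S\<rparr> \<in> {G. monoid G \<and> swap_law n G}" by simp
next
  fix I :: "'u set" and F :: "'u \<Rightarrow> 'u monoid" and P :: "'u monoid"
  assume *: "(\<forall>i\<in>I. F i \<in> {G. monoid G \<and> swap_law n G}) \<and> monoid P \<and> P \<cong> product_group I F"
  then obtain f where f: "f \<in> iso P (product_group I F)" by (auto simp: is_iso_def)
  have "swap_law n P"
  proof (rule swap_law_separated)
    fix p q
    assume pq: "p \<in> carrier P" "q \<in> carrier P"
      and sep: "\<And>(K :: 'u monoid) h. monoid K \<Longrightarrow> swap_law n K \<Longrightarrow> h \<in> hom P K \<Longrightarrow> h p = h q"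
    have fm: "f p \<in> (\<Pi>\<^sub>E i\<in>I. carrier (F i))" "f q \<in> (\<Pi>\<^sub>E i\<in>I. carrier (F i))"
      using f pq by (auto simp: iso_def bij_betw_def)
    \<comment> \<open>The separating family consists of the coordinate projections composed with
      \<open>f\<close>.\<close>
    have "f p i = f q i" if "i \<in> I" for i
    proof (rule sep)
      show "(\<lambda>x. f x i) \<in> hom P (F i)"
        using f that by (auto simp: iso_def hom_def Pi_iff PiE_iff)
    qed (use * that in auto)
    then have "f p = f q" using fm by (rule PiE_ext[rotated 2])
    then show "p = q" using f pq by (auto simp: iso_def bij_betw_def inj_on_def)
  qed (use * in simp)
  with * show "P \<in> {G. monoid G \<and> swap_law n G}" by simp
qed simp

lemma swap_law_iso:
  fixes G :: "'a monoid" and H :: "'b monoid"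
  assumes "monoid G" "monoid H" "G \<cong> H"
  shows "swap_law n G \<longleftrightarrow> swap_law n H"
proof -
  obtain f where f: "f \<in> hom G H" "bij_betw f (carrier G) (carrier H)"
    using assms(3) by (auto simp: is_iso_def iso_def)
  show ?thesis
  proof
    assume "swap_law n G"
    with f show "swap_law n H"
      by (intro swap_law_epi[OF assms(1,2), of f]) (auto simp: epi_def bij_betw_def)
  next
    assume H: "swap_law n H"
    show "swap_law n G"
    proof (rule swap_law_separated[OF assms(1)])
      fix p q
      assume pq: "p \<in> carrier G" "q \<in> carrier G" and
        "\<And>(K :: 'b monoid) h. monoid K \<Longrightarrow> swap_law n K \<Longrightarrow> h \<in> hom G K \<Longrightarrow> h p = h q"
      then have "f p = f q" using assms(2) H f(1) by blast
      with pq f(2) show "p = q" by (auto simp: bij_betw_def inj_on_def)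
    qed
  qed
qed

section \<open>The identity in quotients of free monoids, as a statement about words\<close>

lemma swap_law_word_quotient:
  assumes eq: "equiv (lists A) r"
    and app: "\<And>u v u' v'. (u, v) \<in> r \<Longrightarrow> (u', v') \<in> r \<Longrightarrow> (u @ u', v @ v') \<in> r"
  shows "swap_law n (word_quotient A r) \<longleftrightarrow> (\<forall>u\<in>lists A. \<forall>v\<in>lists A.
    (concat (replicate n (u @ v)) @ u @ v, concat (replicate n (u @ v)) @ v @ u) \<in> r)"
proof -
  let ?Q = "word_quotient A r"
  interpret Q: monoid ?Q by (rule monoid_word_quotient[OF eq app])
  have mult: "r `` {u} \<otimes>\<^bsub>?Q\<^esub> r `` {v} = r `` {u @ v}" if "u \<in> lists A" "v \<in> lists A" for u v
    using mult_word_quotient[OF eq _ that] app by blast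
  have car: "carrier ?Q = (\<lambda>u. r `` {u}) ` lists A"
    by (auto simp: word_quotient_def quotient_def)
  have rep: "concat (replicate k u) \<in> lists A" if "u \<in> lists A" for k u
    using that by (induction k) auto
  have pow: "r `` {u} [^]\<^bsub>?Q\<^esub> k = r `` {concat (replicate k u)}" if "u \<in> lists A" for u k
  proof (induction k)
    case (Suc k)
    \<comment> \<open>Powers recurse by multiplying on the right, but
      \<open>concat (replicate (Suc k) u)\<close> unfolds with the new copy of \<open>u\<close> in
      front.\<close>
    have "r `` {u} [^]\<^bsub>?Q\<^esub> Suc k = r `` {u} \<otimes>\<^bsub>?Q\<^esub> r `` {u} [^]\<^bsub>?Q\<^esub> k"
      by (rule Q.nat_pow_Suc2) (use that in \<open>simp add: car\<close>)
    then show ?case using Suc that by (simp add: mult rep)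
  qed (simp add: word_quotient_def)
  show ?thesis
    unfolding swap_law_def car ball_simps
    by (intro ball_cong[OF HOL.refl])
      (simp add: mult pow rep eq_equiv_class_iff[OF eq])
qed


lemma swap_law_presented_monoid:
  "swap_law n (presented_monoid A R) \<longleftrightarrow> (\<forall>u\<in>lists A. \<forall>v\<in>lists A.
    (concat (replicate n (u @ v)) @ u @ v, concat (replicate n (u @ v)) @ v @ u)
      \<in> generated_congruence A R)"
  unfolding presented_monoid_def
  by (rule swap_law_word_quotient[OF equiv_generated_congruence generated_congruence.append])

lemma concat_replicate_Suc: "concat (replicate (Suc k) w) = concat (replicate k w) @ w"
  by (induction k) simp_all


section \<open>Right patience sorting satisfies the identity\<close>

definition bottoms :: "nat list list \<Rightarrow> nat set" where
  "bottoms T = last ` set T"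

lemma rps_ok_bottoms_gt: "rps_ok (C # T) \<Longrightarrow> b \<in> bottoms T \<Longrightarrow> last C < b"
proof (induction T arbitrary: C)
  case (Cons D T)
  then show ?case by (fastforce simp: bottoms_def)
qed (simp add: bottoms_def)

text \<open>The bottom row is strictly increasing, so the column with bottom entry \<open>a\<close>
  is unique and is the leftmost one with bottom entry at least \<open>a\<close>.\<close>

lemma rps_insert_bottom:
  "rps_ok T \<Longrightarrow> a \<in> bottoms T \<Longrightarrow>
     rps_insert a T = map (\<lambda>C. if last C = a then C @ [a] else C) T"
proof (induction T)
  case (Cons C T)
  have gt: "last C < b" if "b \<in> bottoms T" for b
    using rps_ok_bottoms_gt Cons.prems(1) that by blast
  show ?case
  proof (cases "a \<le> last C")
    case True
    then have "a = last C" using Cons.prems(2) gt[of a] by (auto simp: bottoms_def)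
    moreover have "last D \<noteq> last C" if "D \<in> set T" for D
      using gt[of "last D"] that by (auto simp: bottoms_def)
    ultimately show ?thesis by (auto intro: map_idI[symmetric])
  next
    case False
    then have "a \<in> bottoms T" using Cons.prems(2) by (auto simp: bottoms_def)
    then show ?thesis using False Cons by simp
  qed
qed (simp add: bottoms_def)

lemma bottoms_insert_self: "a \<in> bottoms (rps_insert a T)"
  by (induction T) (auto simp: bottoms_def)

text \<open>Inserting \<open>a\<close> can only cover a bottom entry that is at least
  \<open>a\<close>.\<close>

lemma bottoms_insert_less: "b \<in> bottoms T \<Longrightarrow> b < a \<Longrightarrow> b \<in> bottoms (rps_insert a T)"
  by (induction T) (auto simp: bottoms_def)

lemma bottoms_insert_bottom:
  "rps_ok T \<Longrightarrow> a \<in> bottoms T \<Longrightarrow> bottoms (rps_insert a T) = bottoms T"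
  unfolding rps_insert_bottom unfolding bottoms_def set_map image_image
  by (rule image_cong) simp_all

text \<open>Each insertion repeats the bottom entry of the column it extends. The bottom row
  therefore never changes, and every later letter still finds its own column.\<close>

lemma fold_rps_insert_bottoms:
  "rps_ok T \<Longrightarrow> set w \<subseteq> bottoms T \<Longrightarrow>
     fold rps_insert w T = map (\<lambda>C. C @ filter ((=) (last C)) w) T"
proof (induction w arbitrary: T)
  case (Cons a w)
  then have "fold rps_insert (a # w) T =
      map (\<lambda>C. C @ filter ((=) (last C)) w) (rps_insert a T)"
    by (simp add: rps_ok_insert bottoms_insert_bottom)
  also have "\<dots> = map (\<lambda>C. C @ filter ((=) (last C)) (a # w)) T"
    using Cons.prems by (auto simp: rps_insert_bottom)
  finally show ?case .
qed simp

text \<open>Both sides are powers of the single letter \<open>c\<close>, so only the number of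
  occurrences counts.\<close>

lemma filter_eq_append_commute:
  "filter ((=) c) (u @ v) = filter ((=) c) (v @ u)"
proof -
  have "filter ((=) c) w = replicate (length (filter ((=) c) w)) c" for w
    using replicate_length_filter[of c w] by simp
  then show ?thesis by (metis filter_append length_append add.commute)
qed

section \<open>Growth of the set of bottom entries under repeated reading of a word\<close>

lemma small_bottoms_insert:
  assumes "rps_ok T" "{b \<in> A. b \<le> k} \<subseteq> bottoms T" "a \<in> A"
  shows "{b \<in> A. b \<le> k} \<subseteq> bottoms (rps_insert a T)"
proof
  fix b assume b: "b \<in> {b \<in> A. b \<le> k}"
  consider "b < a" | "b = a" | "a < b" by linarith
  then show "b \<in> bottoms (rps_insert a T)"
  proof cases
    case 1 then show ?thesis using b assms(2) by (blast intro: bottoms_insert_less)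
  next
    case 2 then show ?thesis by (simp add: bottoms_insert_self)
  next
    \<comment> \<open>Only a smaller letter \<open>a\<close> could cover \<open>b\<close>; but then
      \<open>a\<close> is itself below the threshold, hence already a bottom entry, and goes to its
      own column.\<close>
    case 3
    then have "a \<in> bottoms T" using b assms(2,3) by auto
    then show ?thesis using b assms(1,2) by (auto simp: bottoms_insert_bottom)
  qed
qed

lemma small_bottoms_fold:
  "rps_ok T \<Longrightarrow> {b \<in> A. b \<le> k} \<subseteq> bottoms T \<Longrightarrow> set w \<subseteq> A \<Longrightarrow>
     {b \<in> A. b \<le> k} \<subseteq> bottoms (fold rps_insert w T)"
  by (induction w arbitrary: T) (simp_all add: rps_ok_insert small_bottoms_insert)

lemma small_bottoms_fold_Suc:
  assumes "rps_ok T" "{b \<in> set z. b \<le> k} \<subseteq> bottoms T"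
  shows "{b \<in> set z. b \<le> Suc k} \<subseteq> bottoms (fold rps_insert z T)"
proof (cases "Suc k \<in> set z")
  case True
  then obtain p q where z: "z = p @ Suc k # q" by (blast dest: split_list)
  let ?U = "fold rps_insert p T"
  have ok: "rps_ok ?U" using assms(1) by (rule rps_ok_fold)
  have "{b \<in> set z. b \<le> k} \<subseteq> bottoms (rps_insert (Suc k) ?U)"
    using assms True ok z by (intro small_bottoms_insert small_bottoms_fold) auto
  then have "{b \<in> set z. b \<le> Suc k} \<subseteq> bottoms (rps_insert (Suc k) ?U)"
    using bottoms_insert_self[of "Suc k" ?U] by (auto simp: le_Suc_eq)
  then have "{b \<in> set z. b \<le> Suc k} \<subseteq> bottoms (fold rps_insert q (rps_insert (Suc k) ?U))"
    using ok by (intro small_bottoms_fold rps_ok_insert) (auto simp: z)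
  then show ?thesis by (simp add: z)
next
  case False
  then have "{b \<in> set z. b \<le> Suc k} = {b \<in> set z. b \<le> k}" by (auto simp: le_Suc_eq)
  then show ?thesis using small_bottoms_fold[OF assms] by simp
qed

lemma small_bottoms_power:
  assumes "0 \<notin> set z"
  shows "{b \<in> set z. b \<le> k} \<subseteq> bottoms (rps_tableau (concat (replicate k z)))"
proof (induction k)
  case 0
  then show ?case using assms by (auto intro: gr0I)
next
  case (Suc k)
  have "rps_ok (rps_tableau (concat (replicate k z)))"
    unfolding rps_tableau_def by (rule rps_ok_fold) simp
  from small_bottoms_fold_Suc[OF this Suc] show ?case
    by (simp only: concat_replicate_Suc) (simp add: rps_tableau_def)
qed

lemma rps_tableau_swap:
  assumes "set u \<subseteq> {1..n}" "set v \<subseteq> {1..n}"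
  shows "rps_tableau (concat (replicate n (u @ v)) @ u @ v) =
    rps_tableau (concat (replicate n (u @ v)) @ v @ u)"
proof -
  let ?T = "rps_tableau (concat (replicate n (u @ v)))"
  have "set (u @ v) = {b \<in> set (u @ v). b \<le> n}" "0 \<notin> set (u @ v)"
    using assms by auto
  then have sub: "set (u @ v) \<subseteq> bottoms ?T"
    using small_bottoms_power[of "u @ v" n] by simp
  have "rps_ok ?T" unfolding rps_tableau_def by (rule rps_ok_fold) simp
  then have "fold rps_insert w ?T = map (\<lambda>C. C @ filter ((=) (last C)) w) ?T"
    if "w \<in> {u @ v, v @ u}" for w
    using that sub by (intro fold_rps_insert_bottoms) auto
  then have "fold rps_insert (u @ v) ?T = fold rps_insert (v @ u) ?T"
    by (simp only: filter_eq_append_commute[of _ u v] insert_iff simp_thms)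
  then show ?thesis by (simp add: rps_tableau_def)
qed

lemma swap_law_rPS: "swap_law n (rPS n)"
proof -
  have eq: "equiv (lists {1..n}) (rps_congruence n)"
    by (rule equivI) (auto simp: rps_congruence_def refl_on_def sym_def trans_def)
  have rep: "concat (replicate k w) \<in> lists {1..n}" if "w \<in> lists {1..n}" for k w
    using that by (induction k) auto
  have "(concat (replicate n (u @ v)) @ u @ v, concat (replicate n (u @ v)) @ v @ u)
      \<in> rps_congruence n" if "u \<in> lists {1..n}" "v \<in> lists {1..n}" for u v
    using that rep[of "u @ v" n] rps_tableau_swap[of u n v]
    by (auto simp: rps_congruence_def lists_eq_set)
  then show ?thesis unfolding rPS_def
    by (subst swap_law_word_quotient[OF eq])
      (auto simp: rps_congruence_def intro: rps_tableau_append_cong)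
qed


section \<open>The stylic monoid violates the identity\<close>

definition decreasing_profile :: "nat list \<Rightarrow> (nat \<times> nat \<times> nat) set" where
  "decreasing_profile w = {(i, j, k). \<exists>s. subseq s w \<and> sorted_wrt (>) s \<and>
     set s \<subseteq> {i..<j} \<and> length s = k}"

lemma decreasing_profile_append:
  "(i, j, k) \<in> decreasing_profile (u @ v) \<longleftrightarrow> (\<exists>h a b. k = a + b \<and>
     (max i h, j, a) \<in> decreasing_profile u \<and> (i, min h j, b) \<in> decreasing_profile v)"
  (is "?L \<longleftrightarrow> ?R")
proof
  assume ?L
  then obtain s1 s2 where s: "subseq s1 u" "subseq s2 v" "sorted_wrt (>) (s1 @ s2)"
      "set (s1 @ s2) \<subseteq> {i..<j}" "length (s1 @ s2) = k"
    unfolding decreasing_profile_def by (auto elim!: subseq_appendE)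
  define h where "h = (if s2 = [] then i else Suc (Max (set s2)))"
  have "x < h" if "x \<in> set s2" for x
    using that Max_ge[of "set s2" x] by (auto simp: h_def less_Suc_eq_le)
  moreover have "h \<le> x" if "x \<in> set s1" for x
    using that s(3,4) by (auto simp: h_def Suc_le_eq sorted_wrt_append)
  ultimately have "set s1 \<subseteq> {max i h..<j}" "set s2 \<subseteq> {i..<min h j}"
    using s(4) by auto
  moreover have "sorted_wrt (>) s1" "sorted_wrt (>) s2" "k = length s1 + length s2"
    using s(3,5) by (auto simp: sorted_wrt_append)
  ultimately show ?R using s(1,2) unfolding decreasing_profile_def by blast
next
  assume ?R
  then obtain h s1 s2 where s: "subseq s1 u" "subseq s2 v" "sorted_wrt (>) s1" "sorted_wrt (>) s2"
      "set s1 \<subseteq> {max i h..<j}" "set s2 \<subseteq> {i..<min h j}" "k = length s1 + length s2"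
    unfolding decreasing_profile_def by blast
  have "sorted_wrt (>) (s1 @ s2)" "set (s1 @ s2) \<subseteq> {i..<j}" "length (s1 @ s2) = k"
    using s by (fastforce simp: sorted_wrt_append)+
  then show ?L using list_emb_append_mono[OF s(1,2)] unfolding decreasing_profile_def by blast
qed

lemma decreasing_profile_appendI:
  assumes "(h, j, a) \<in> decreasing_profile u" "(i, h, b) \<in> decreasing_profile v" "i \<le> h" "h \<le> j"
  shows "(i, j, a + b) \<in> decreasing_profile (u @ v)"
  unfolding decreasing_profile_append
  using assms by (intro exI[of _ h] exI[of _ a] exI[of _ b]) (simp add: max_def min_def)

lemma decreasing_profile_subseqs:
  "decreasing_profile w = {(i, j, k). \<exists>s\<in>set (subseqs w). sorted_wrt (>) s \<and>
     set s \<subseteq> {i..<j} \<and> length s = k}"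
  by (auto simp: decreasing_profile_def)

lemma decreasing_profile_stylic_relations:
  assumes "(u, v) \<in> stylic_relations n"
  shows "decreasing_profile u = decreasing_profile v"
proof -
  from assms consider
      a b c where "u = [a, c, b]" "v = [c, a, b]" "a \<le> b" "b < c"
    | a b c where "u = [b, a, c]" "v = [b, c, a]" "a < b" "b \<le> c"
    | a where "u = [a, a]" "v = [a]"
    unfolding stylic_relations_def
    by (elim UnE CollectE exE conjE Pair_inject) metis+
  then show ?thesis
    by cases (auto simp: decreasing_profile_subseqs Let_def)
qed

lemma decreasing_profile_stylic_congruence:
  "(u, v) \<in> generated_congruence A (stylic_relations n) \<Longrightarrow>
     decreasing_profile u = decreasing_profile v"
proof (induction rule: generated_congruence.induct)
  case (append u v u' v')
  have "(i, j, k) \<in> decreasing_profile (u @ u') \<longleftrightarrow> (i, j, k) \<in> decreasing_profile (v @ v')" for i j k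
    unfolding decreasing_profile_append append.IH ..
  then show ?case by auto
qed (auto dest: decreasing_profile_stylic_relations)

lemma decreasing_profile_increasing:
  assumes "sorted_wrt (<) w" "(i, j, k) \<in> decreasing_profile w"
  shows "k \<le> 1"
proof -
  obtain s where s: "subseq s w" "sorted_wrt (>) s" "length s = k"
    using assms(2) by (auto simp: decreasing_profile_def)
  have "sorted_wrt (<) s" using s(1) assms(1)
    by (induction rule: list_emb.induct) (auto dest: list_emb_set)
  with s(2,3) show ?thesis by (cases s rule: list.exhaust; cases "tl s") auto
qed

lemma decreasing_profile_block:
  assumes "(i, j, k) \<in> decreasing_profile ([2..<m] @ [1])"
  shows "k \<le> 1 + of_bool (i \<le> 1)"
proof -
  obtain h a b where k: "k = a + b" and ab: "(max i h, j, a) \<in> decreasing_profile [2..<m]"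
    "(i, min h j, b) \<in> decreasing_profile [1]"
    using assms by (auto simp: decreasing_profile_append)
  have "a \<le> 1" by (rule decreasing_profile_increasing[OF _ ab(1)]) simp
  moreover have "b \<le> of_bool (i \<le> 1)"
    using ab(2) by (auto simp: decreasing_profile_subseqs Let_def)
  ultimately show ?thesis using k by linarith
qed

lemma decreasing_profile_blocks_le:
  "1 \<le> i \<Longrightarrow> (i, j, k) \<in> decreasing_profile (concat (replicate l ([2..<m] @ [1]))) \<Longrightarrow>
     k \<le> l + of_bool (i \<le> 1)"
proof (induction l arbitrary: i j k)
  case 0
  then have "k = 0" by (auto simp: decreasing_profile_def)
  then show ?case by simp
next
  case (Suc l)
  let ?w = "[2..<m] @ [1]"
  obtain h a b where k: "k = a + b" and a: "(max i h, j, a) \<in> decreasing_profile ?w"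
    and b: "(i, min h j, b) \<in> decreasing_profile (concat (replicate l ?w))"
    using Suc.prems(2) unfolding replicate_Suc concat.simps decreasing_profile_append[of i j k ?w]
    by blast
  note le = decreasing_profile_block[OF a] Suc.IH[OF Suc.prems(1) b]
  show ?case
  proof (cases "max i h \<le> 1")
    case True
    then have "b = 0" using b Suc.prems(1) by (auto simp: decreasing_profile_def)
    then show ?thesis using le k True by simp
  next
    case False
    then show ?thesis using le k by (cases "i \<le> 1") auto
  qed
qed

lemma decreasing_profile_blocks_mem:
  "l + 2 \<le> m \<Longrightarrow> (m - l, m, l) \<in> decreasing_profile (concat (replicate l ([2..<m] @ [1])))"
proof (induction l)
  case 0
  then show ?case by (simp add: decreasing_profile_def)
next
  case (Suc l)
  let ?w = "[2..<m] @ [1]"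
  have "subseq [m - Suc l] ?w" using Suc.prems by (simp add: subseq_singleton_left) arith
  then have "(m - Suc l, m - l, 1) \<in> decreasing_profile ?w"
    using Suc.prems unfolding decreasing_profile_def
    by (intro CollectI case_prodI exI[of _ "[m - Suc l]"]) auto
  with Suc have "(m - Suc l, m, l + 1) \<in> decreasing_profile (concat (replicate l ?w) @ ?w)"
    by (intro decreasing_profile_appendI[of "m - l"]) auto
  then show ?case by (simp only: concat_replicate_Suc flip: Suc_eq_plus1)
qed

lemma not_swap_law_styl: "\<not> swap_law n (styl (n + 2))"
proof
  let ?x = "[2..<n + 3]" and ?y = "[1::nat]"
  let ?p = "concat (replicate n (?x @ ?y))"
  assume "swap_law n (styl (n + 2))"
  moreover have "?x \<in> lists {1..n + 2}" "?y \<in> lists {1..n + 2}" by auto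
  ultimately have "(?p @ ?x @ ?y, ?p @ ?y @ ?x) \<in>
      generated_congruence {1..n + 2} (stylic_relations (n + 2))"
    unfolding styl_def swap_law_presented_monoid by blast
  then have eq: "decreasing_profile (?p @ ?x @ ?y) = decreasing_profile (?p @ ?y @ ?x)"
    by (rule decreasing_profile_stylic_congruence)
  have "subseq [2, 1] (?x @ ?y)" by (subst upt_conv_Cons) auto
  then have "(1, 3, 2) \<in> decreasing_profile (?x @ ?y)"
    unfolding decreasing_profile_def by (intro CollectI case_prodI exI[of _ "[2, 1]"]) auto
  then have "(1, n + 3, n + 2) \<in> decreasing_profile (?p @ ?x @ ?y)"
    using decreasing_profile_blocks_mem[of n "n + 3"]
    by (intro decreasing_profile_appendI[of 3]) auto
  then obtain h a b where k: "n + 2 = a + b" and a: "(max 1 h, n + 3, a) \<in> decreasing_profile ?p"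
    and b: "(1, min h (n + 3), b) \<in> decreasing_profile (?y @ ?x)"
    unfolding eq decreasing_profile_append[of _ _ _ ?p] by blast
  have "b \<le> 1" by (rule decreasing_profile_increasing[OF _ b]) simp
  moreover have "a \<le> n + of_bool (max 1 h \<le> 1)"
    using a by (intro decreasing_profile_blocks_le) auto
  moreover have "b = 0" if "max 1 h \<le> 1"
    using b that by (auto simp: decreasing_profile_def)
  ultimately show False using k by (cases "max 1 h \<le> 1") auto
qed

theorem corollary4p11:
  fixes n :: nat
  assumes "n \<ge> 1"
  shows "\<not> (\<exists>S \<in> (variety_generated_by (rPS n) :: 'u monoid set). S \<cong> styl (n + 2))"
proof
  let ?K = "{G :: 'u monoid. monoid G \<and> swap_law n G}"
  assume "\<exists>S \<in> (variety_generated_by (rPS n) :: 'u monoid set). S \<cong> styl (n + 2)"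
  then obtain S :: "'u monoid" where S: "S \<in> variety_generated_by (rPS n)" "S \<cong> styl (n + 2)"
    by blast
  have "{G. monoid G \<and> G \<cong> rPS n} \<subseteq> ?K"
    using swap_law_iso[OF _ monoid_rPS] swap_law_rPS by blast
  then have "S \<in> ?K"
    using S(1) monoid_variety_swap_law unfolding variety_generated_by_def by blast
  then show False
    using swap_law_iso[OF _ monoid_styl S(2)] not_swap_law_styl by blast
qed

end
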